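(* Let $\kappa$ be an infinite cardinal. Then forcing with $\mathbb{R}(\kappa) \times \mathbb{R}(\kappa)$ adds a generic filter for $\mathbb{C}(\kappa)$; that is, if $G \times H$ is $\mathbb{R}(\kappa) \times \mathbb{R}(\kappa)$-generic over $V$, then $V[G\times H]$ contains a filter that is $\mathbb{C}(\kappa)$-generic over $V$.
   Context: For an infinite cardinal $\kappa$, $\mathbb{C}(\kappa)$ is the forcing for adding $\kappa$-many Cohen reals: the set of finite partial functions $p$ from $\kappa \times \omega$ to $2$, ordered by reverse inclusion. Consider $2^{\kappa \times \omega}$ with the standard product measure $\mu_\kappa$. The Borel sets are the members of the $\sigma$-algebra $\mathbb{B}(\kappa)$ generated by the basic open sets $\{x \in 2^{\kappa\times\omega} : x \supseteq s\}$, $s \in \mathbb{C}(\kappa)$, and $\mu_\kappa(\{x : x \supseteq s\}) = 2^{-|s|}$. For $S, T \in \mathbb{B}(\kappa)$ let $S \sim T$ iff $S \bigtriangleup T$ is null. $\mathbb{R}(\kappa) = \mathbb{B}(\kappa)/\!\sim$, the forcing for adding $\kappa$-many random reals, is ordered by $[S] \le [T]$ iff $\mu_\kappa(S \setminus T) = 0$ (forcing conditions are the nonzero classes). All forcing notions are computed in $V$. *)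

theory Defs
  imports "HOL-Probability.Probability"
begin

section \<open>Forcing notions\<close>

text \<open>
  A forcing notion is a preorder \<open>r\<close>, where \<open>(q, p) \<in> r\<close> means \<open>q \<le> p\<close> (the condition \<open>q\<close> is
  stronger than \<open>p\<close>); its conditions are the elements of \<open>Field r\<close>.
\<close>

definition dense_in :: "'p rel \<Rightarrow> 'p set \<Rightarrow> bool" where
  "dense_in r D \<longleftrightarrow> D \<subseteq> Field r \<and> (\<forall>p\<in>Field r. \<exists>q\<in>D. (q, p) \<in> r)"

definition dense_below :: "'p rel \<Rightarrow> ('p \<Rightarrow> bool) \<Rightarrow> 'p \<Rightarrow> bool" where
  "dense_below r X p \<longleftrightarrow> (\<forall>q. (q, p) \<in> r \<longrightarrow> (\<exists>t. (t, q) \<in> r \<and> X t))"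

definition product_forcing :: "'p rel \<Rightarrow> 'q rel \<Rightarrow> ('p \<times> 'q) rel" where
  "product_forcing r s = {((p', q'), (p, q)). (p', p) \<in> r \<and> (q', q) \<in> s}"


section \<open>Cohen and random forcing\<close>

definition cohen_forcing :: "'k rel \<Rightarrow> ('k \<times> nat \<rightharpoonup> bool) rel" where
  "cohen_forcing \<kappa> = {(q, p). finite (dom q) \<and> dom q \<subseteq> Field \<kappa> \<times> UNIV \<and> p \<subseteq>\<^sub>m q}"

definition cantor_measure :: "'k rel \<Rightarrow> ('k \<times> nat \<Rightarrow> bool) measure" where
  "cantor_measure \<kappa> = (\<Pi>\<^sub>M i \<in> Field \<kappa> \<times> UNIV. uniform_count_measure (UNIV :: bool set))"

definition basic_open :: "'k rel \<Rightarrow> ('k \<times> nat \<rightharpoonup> bool) \<Rightarrow> ('k \<times> nat \<Rightarrow> bool) set" where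
  "basic_open \<kappa> s = {x \<in> space (cantor_measure \<kappa>). \<forall>i\<in>dom s. s i = Some (x i)}"

definition null_equiv :: "'k rel \<Rightarrow> ('k \<times> nat \<Rightarrow> bool) set rel" where
  "null_equiv \<kappa> = {(S, T). S \<in> sets (cantor_measure \<kappa>) \<and> T \<in> sets (cantor_measure \<kappa>) \<and>
     sym_diff S T \<in> null_sets (cantor_measure \<kappa>)}"

definition random_conditions :: "'k rel \<Rightarrow> ('k \<times> nat \<Rightarrow> bool) set set set" where
  "random_conditions \<kappa> = sets (cantor_measure \<kappa>) // null_equiv \<kappa> - {null_equiv \<kappa> `` {{}}}"

definition random_forcing :: "'k rel \<Rightarrow> ('k \<times> nat \<Rightarrow> bool) set set rel" where
  "random_forcing \<kappa> = {(A, B). A \<in> random_conditions \<kappa> \<and> B \<in> random_conditions \<kappa> \<and>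
     (\<exists>S\<in>A. \<exists>T\<in>B. emeasure (cantor_measure \<kappa>) (S - T) = 0)}"

lemma Field_cohen_forcing:
  "Field (cohen_forcing \<kappa>) = {p. finite (dom p) \<and> dom p \<subseteq> Field \<kappa> \<times> UNIV}"
proof (intro set_eqI iffI)
  fix p assume "p \<in> Field (cohen_forcing \<kappa>)"
  then obtain q where "finite (dom q)" "dom q \<subseteq> Field \<kappa> \<times> UNIV" "p \<subseteq>\<^sub>m q"
    by (auto simp: cohen_forcing_def Field_def)
  then show "p \<in> {p. finite (dom p) \<and> dom p \<subseteq> Field \<kappa> \<times> UNIV}"
    using map_le_implies_dom_le[of p q] finite_subset[of "dom p" "dom q"] by blast
next
  fix p :: "'a \<times> nat \<rightharpoonup> bool"
  assume "p \<in> {p. finite (dom p) \<and> dom p \<subseteq> Field \<kappa> \<times> UNIV}"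
  then have "(p, p) \<in> cohen_forcing \<kappa>" by (simp add: cohen_forcing_def)
  then show "p \<in> Field (cohen_forcing \<kappa>)" by (rule FieldI1)
qed

text \<open>
  The library's product measure is the measure described by the basic open sets: they generate its
  \<open>\<sigma>\<close>-algebra, and the set determined by \<open>s\<close> has measure \<open>2\<close> to the power \<open>- |s|\<close>.
\<close>

lemma space_cantor_measure: "space (cantor_measure \<kappa>) = (Field \<kappa> \<times> UNIV) \<rightarrow>\<^sub>E UNIV"
  by (simp add: cantor_measure_def space_PiM space_uniform_count_measure)

lemma basic_open_eq:
  "basic_open \<kappa> s = prod_emb (Field \<kappa> \<times> UNIV) (\<lambda>_. uniform_count_measure UNIV)
    (dom s) (\<Pi>\<^sub>E i\<in>dom s. {the (s i)})"
proof -
  have "s i = Some b \<longleftrightarrow> b = the (s i)" if "i \<in> dom s" for i b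
    using that by force
  then show ?thesis
    by (simp add: basic_open_def prod_emb_def space_cantor_measure space_uniform_count_measure
        restrict_PiE_iff set_eq_iff Pi_iff conj_commute)
qed

lemma emeasure_basic_open:
  assumes "s \<in> Field (cohen_forcing \<kappa>)"
  shows "emeasure (cantor_measure \<kappa>) (basic_open \<kappa> s) = (1 / 2) ^ card (dom s)"
proof -
  interpret product_prob_space "\<lambda>_. uniform_count_measure (UNIV :: bool set)" "Field \<kappa> \<times> UNIV"
    by (intro product_prob_spaceI prob_space_uniform_count_measure) auto
  have "emeasure (cantor_measure \<kappa>) (basic_open \<kappa> s)
      = (\<Prod>i\<in>dom s. emeasure (uniform_count_measure UNIV) {the (s i)})"
    unfolding basic_open_eq cantor_measure_def using assms
    by (intro emeasure_PiM_emb) (auto simp: Field_cohen_forcing sets_uniform_count_measure)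
  also have "\<dots> = (\<Prod>i\<in>dom s. 1 / 2)"
    by (intro prod.cong refl) (simp add: emeasure_uniform_count_measure divide_ennreal_def)
  also have "\<dots> = (1 / 2) ^ card (dom s)"
    by simp
  finally show ?thesis .
qed

lemma sets_cantor_measure:
  "sets (cantor_measure \<kappa>)
    = sigma_sets (space (cantor_measure \<kappa>)) (basic_open \<kappa> ` Field (cohen_forcing \<kappa>))"
proof
  let ?I = "Field \<kappa> \<times> (UNIV :: nat set)" and ?M = "\<lambda>_. uniform_count_measure (UNIV :: bool set)"
  let ?X = "space (cantor_measure \<kappa>)"
  let ?G = "sigma_sets ?X (basic_open \<kappa> ` Field (cohen_forcing \<kappa>))"
  interpret G: sigma_algebra ?X ?G
    by (rule sigma_algebra_sigma_sets) (auto simp: basic_open_def)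
  have pt: "{x \<in> ?X. x i = b} \<in> ?G" if "i \<in> ?I" for i b
  proof -
    have "{x \<in> ?X. x i = b} = basic_open \<kappa> [i \<mapsto> b]"
      by (auto simp: basic_open_def)
    then show ?thesis using that by (auto simp: Field_cohen_forcing)
  qed
  have "{x \<in> ?X. x i \<in> A} \<in> ?G" if "i \<in> ?I" for i A
  proof -
    have "{x \<in> ?X. x i \<in> A} = (\<Union>b\<in>A. {x \<in> ?X. x i = b})" by auto
    also have "\<dots> \<in> ?G" using pt[OF that] by (intro G.finite_UN) auto
    finally show ?thesis .
  qed
  then have "{{f \<in> \<Pi>\<^sub>E i\<in>?I. space (?M i). f i \<in> A} | i A. i \<in> ?I \<and> A \<in> sets (?M i)} \<subseteq> ?G"
    by (auto simp: space_cantor_measure space_uniform_count_measure)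
  then show "sets (cantor_measure \<kappa>) \<subseteq> ?G"
    using G.sigma_sets_subset
    by (simp add: cantor_measure_def sets_PiM_single space_PiM)
  have "basic_open \<kappa> s \<in> sets (cantor_measure \<kappa>)" if "s \<in> Field (cohen_forcing \<kappa>)" for s
    unfolding basic_open_eq cantor_measure_def using that
    by (intro sets_PiM_I) (auto simp: Field_cohen_forcing sets_uniform_count_measure)
  then show "?G \<subseteq> sets (cantor_measure \<kappa>)"
    by (intro sets.sigma_sets_subset) auto
qed


section \<open>Names\<close>

text \<open>
  The ground model \<open>V\<close> is the universe of HOL, with the objects of type \<open>'a\<close> as urelements; in the
  application these are the conditions of the forcing notion for which a generic filter is added.
  The name \<open>Name e c\<close> stands for the set \<open>{(e i, s) | i s. s \<in> c i}\<close> of pairs of a name and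
  a condition. Members of some \<open>c i\<close> outside \<open>Field r\<close> have no effect below.

  The index type bounds the hereditary size of names. It is large enough for every set of
  urelements of the generic extension to have a name, namely
  \<open>Name (\<lambda>(a, _). Urelem a) (\<lambda>(a, _). c a)\<close> for some \<open>c\<close>.
\<close>

datatype ('a, 'p) name =
    Urelem 'a
  | Name "'a \<times> 'p \<Rightarrow> ('a, 'p) name" "'a \<times> 'p \<Rightarrow> 'p set"

definition check :: "'p rel \<Rightarrow> 'a set \<Rightarrow> ('a, 'p) name" where
  "check r A = Name (\<lambda>(a, _). Urelem a) (\<lambda>(a, _). if a \<in> A then Field r else {})"


section \<open>The forcing relation\<close>

primrec forces_eq :: "'p rel \<Rightarrow> ('a, 'p) name \<Rightarrow> ('a, 'p) name \<Rightarrow> 'p \<Rightarrow> bool" where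
  "forces_eq r (Urelem a) = (\<lambda>y p. y = Urelem a)"
| "forces_eq r (Name e c) = (\<lambda>y p. case y of
     Urelem b \<Rightarrow> False
   | Name e' c' \<Rightarrow>
       (\<forall>i. \<forall>s\<in>c i. \<forall>q. (q, p) \<in> r \<and> (q, s) \<in> r \<longrightarrow>
          dense_below r (\<lambda>t. \<exists>j. \<exists>s'\<in>c' j. (t, s') \<in> r \<and> forces_eq r (e i) (e' j) t) q) \<and>
       (\<forall>j. \<forall>s'\<in>c' j. \<forall>q. (q, p) \<in> r \<and> (q, s') \<in> r \<longrightarrow>
          dense_below r (\<lambda>t. \<exists>i. \<exists>s\<in>c i. (t, s) \<in> r \<and> forces_eq r (e i) (e' j) t) q))"

definition forces_mem :: "'p rel \<Rightarrow> ('a, 'p) name \<Rightarrow> ('a, 'p) name \<Rightarrow> 'p \<Rightarrow> bool" where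
  "forces_mem r x y p = (case y of
     Urelem b \<Rightarrow> False
   | Name e c \<Rightarrow> dense_below r (\<lambda>t. \<exists>i. \<exists>s\<in>c i. (t, s) \<in> r \<and> forces_eq r x (e i) t) p)"

lemma forces_eq_sym: "forces_eq r x y p \<longleftrightarrow> forces_eq r y x p"
proof (induction x arbitrary: y p)
  case (Urelem a)
  then show ?case by (cases y) auto
next
  case (Name e c)
  then show ?case by (cases y) auto
qed

text \<open>Two sets are forced to be equal iff they are forced to have the same elements.\<close>

lemma forces_eq_Name:
  "forces_eq r (Name e c) (Name e' c') p \<longleftrightarrow>
    (\<forall>i. \<forall>s\<in>c i. \<forall>q. (q, p) \<in> r \<and> (q, s) \<in> r \<longrightarrow> forces_mem r (e i) (Name e' c') q) \<and>
    (\<forall>j. \<forall>s\<in>c' j. \<forall>q. (q, p) \<in> r \<and> (q, s) \<in> r \<longrightarrow> forces_mem r (e' j) (Name e c) q)"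
  by (simp add: forces_mem_def forces_eq_sym[of r "e' _"])

text \<open>
  Sentences of the forcing language, with names as parameters. \<open>Forall\<close> quantifies over all elements
  of the generic extension. \<open>Ground_rel R\<close> is the predicate for a relation \<open>R \<in> V\<close> on the
  urelements, and \<open>Forall_ground \<D>\<close> the quantifier over the members of a family \<open>\<D> \<in> V\<close> of sets
  of urelements.
\<close>

datatype ('a, 'p) sentence =
    Eq "('a, 'p) name" "('a, 'p) name"
  | Mem "('a, 'p) name" "('a, 'p) name"
  | Ground_rel "'a rel" "('a, 'p) name" "('a, 'p) name"
  | Neg "('a, 'p) sentence"
  | And "('a, 'p) sentence" "('a, 'p) sentence"
  | Forall "('a, 'p) name \<Rightarrow> ('a, 'p) sentence"
  | Forall_ground "'a set set" "('a, 'p) name \<Rightarrow> ('a, 'p) sentence"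

primrec forces :: "'p rel \<Rightarrow> ('a, 'p) sentence \<Rightarrow> 'p \<Rightarrow> bool" where
  "forces r (Eq x y) = forces_eq r x y"
| "forces r (Mem x y) = forces_mem r x y"
| "forces r (Ground_rel R x y) = dense_below r
     (\<lambda>t. \<exists>(a, b)\<in>R. forces_eq r x (Urelem a) t \<and> forces_eq r y (Urelem b) t)"
| "forces r (Neg \<phi>) = (\<lambda>p. \<forall>q. (q, p) \<in> r \<longrightarrow> \<not> forces r \<phi> q)"
| "forces r (And \<phi> \<psi>) = (\<lambda>p. forces r \<phi> p \<and> forces r \<psi> p)"
| "forces r (Forall \<Phi>) = (\<lambda>p. \<forall>x. forces r (\<Phi> x) p)"
| "forces r (Forall_ground \<D> \<Phi>) = (\<lambda>p. \<forall>D\<in>\<D>. forces r (\<Phi> (check r D)) p)"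

definition Implies :: "('a, 'p) sentence \<Rightarrow> ('a, 'p) sentence \<Rightarrow> ('a, 'p) sentence" where
  "Implies \<phi> \<psi> = Neg (And \<phi> (Neg \<psi>))"

definition Exists :: "(('a, 'p) name \<Rightarrow> ('a, 'p) sentence) \<Rightarrow> ('a, 'p) sentence" where
  "Exists \<Phi> = Neg (Forall (\<lambda>x. Neg (\<Phi> x)))"


section \<open>Adding a generic filter\<close>

text \<open>
  In the following sentences of the forcing language of \<open>r\<close>, \<open>Q\<close> is a forcing notion in \<open>V\<close> and
  \<open>F\<close> a name.
\<close>

definition is_filter :: "'p rel \<Rightarrow> 'a rel \<Rightarrow> ('a, 'p) name \<Rightarrow> ('a, 'p) sentence" where
  "is_filter r Q F =
     And (Forall (\<lambda>x. Implies (Mem x F) (Mem x (check r (Field Q)))))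
    (And (Exists (\<lambda>x. Mem x F))
    (And (Forall (\<lambda>x. Forall (\<lambda>y. Implies (And (Mem x F) (Ground_rel Q x y)) (Mem y F))))
         (Forall (\<lambda>x. Forall (\<lambda>y. Implies (And (Mem x F) (Mem y F))
            (Exists (\<lambda>z. And (Mem z F) (And (Ground_rel Q z x) (Ground_rel Q z y)))))))))"

definition is_generic_filter :: "'p rel \<Rightarrow> 'a rel \<Rightarrow> ('a, 'p) name \<Rightarrow> ('a, 'p) sentence" where
  "is_generic_filter r Q F =
     And (is_filter r Q F)
         (Forall_ground {D. dense_in Q D} (\<lambda>D. Exists (\<lambda>x. And (Mem x F) (Mem x D))))"

text \<open>
  A filter generic over \<open>V\<close> does not exist in \<open>V\<close> for an atomless forcing notion. As usual,
  ``every generic extension of \<open>V\<close> by \<open>r\<close> satisfies \<open>\<phi>\<close>'' means that every condition forces \<open>\<phi>\<close>.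
\<close>

definition adds_generic_filter :: "'p rel \<Rightarrow> 'a rel \<Rightarrow> bool" where
  "adds_generic_filter r Q \<longleftrightarrow> (\<forall>p\<in>Field r. forces r (Exists (\<lambda>F. is_generic_filter r Q F)) p)"

end

theory Submission
  imports Defs
begin

text \<open>
  Let \<open>x\<close> and \<open>y\<close> be the two random points of the Cantor space \<open>2\<close> to the \<open>\<kappa> \<times> \<omega>\<close> added by the two
  factors. Their sum modulo \<open>2\<close> is Cohen generic: the finite partial functions \<open>a \<subseteq> x + y\<close> form the
  required filter. This is a form of Steinhaus's theorem, that the sum of two sets of positive
  measure in a compact group contains a nonempty open set.

  Given a condition \<open>([A], [B])\<close> and a dense set \<open>D\<close> of Cohen conditions, there are cylinders \<open>[u0]\<close>
  and \<open>[v0]\<close> on one and the same finite set of coordinates such that \<open>A\<close> fills more than half of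
  \<open>[u0]\<close> and \<open>B\<close> more than half of \<open>[v0]\<close> (\<open>exists_majority_cylinder\<close>, \<open>majority_extend\<close>). Let
  \<open>t \<in> D\<close> extend \<open>u0 + v0\<close>. The map \<open>u \<mapsto> t + u\<close> is a bijection from the extensions of \<open>u0\<close> to the
  domain of \<open>t\<close> onto those of \<open>v0\<close>. If for each \<open>u\<close> one of \<open>A \<inter> [u]\<close> and \<open>B \<inter> [t + u]\<close> were null,
  then the measures of these two sets would add up to at most that of \<open>[u]\<close>, and summation over \<open>u\<close>
  would contradict the choice of \<open>u0\<close> and \<open>v0\<close>. So there is a \<open>u\<close> for which both sets have positive
  measure (\<open>sum_meets_dense\<close>); they form a condition stronger than \<open>([A], [B])\<close> which forces
  \<open>x + y\<close> to extend \<open>t\<close>.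

  The passage from this density argument to the forcing language is \<open>adds_generic_filterI\<close>: for
  names of sets of urelements, the forcing relation reduces to statements about the sets of
  conditions that put a given urelement into the named set.
\<close>

section \<open>Names for generic filters\<close>

definition ground_name :: "('a \<Rightarrow> 'p set) \<Rightarrow> ('a, 'p) name" where
  "ground_name c = Name (\<lambda>(a, _). Urelem a) (\<lambda>(a, _). c a)"

lemma forces_eq_Urelem: "forces_eq r x (Urelem a) p \<longleftrightarrow> x = Urelem a"
  by (cases x) auto

lemma forces_mem_ground_name:
  "forces_mem r x (ground_name c) p \<longleftrightarrow>
     dense_below r (\<lambda>t. \<exists>a. x = Urelem a \<and> (\<exists>s\<in>c a. (t, s) \<in> r)) p"
  by (simp add: forces_mem_def ground_name_def forces_eq_Urelem conj_commute)

lemma check_eq_ground_name: "check r A = ground_name (\<lambda>a. if a \<in> A then Field r else {})"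
  by (simp add: check_def ground_name_def)

lemma forces_Exists:
  "forces r (Exists \<Phi>) p \<longleftrightarrow> dense_below r (\<lambda>t. \<exists>x. forces r (\<Phi> x) t) p"
  unfolding Exists_def forces.simps dense_below_def by blast

lemma forces_Implies:
  "forces r (Implies \<phi> \<psi>) p \<longleftrightarrow>
     (\<forall>q. (q, p) \<in> r \<longrightarrow> forces r \<phi> q \<longrightarrow> (\<exists>t. (t, q) \<in> r \<and> forces r \<psi> t))"
  by (auto simp: Implies_def)

lemma dense_below_cong:
  assumes "\<And>t. t \<in> Field r \<Longrightarrow> X t \<longleftrightarrow> Y t"
  shows "dense_below r X p \<longleftrightarrow> dense_below r Y p"
  using assms unfolding dense_below_def by (meson FieldI1)

text \<open>
  Here \<open>c a\<close> is the set of conditions that decide \<open>a\<close> to be in the filter. All set-valued names that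
  occur are of the form \<open>ground_name c\<close>, whose only possible members are urelements. The
  quantifiers over all names in the sentence ``\<open>F\<close> is a generic filter'' therefore reduce to
  quantifiers over the urelements, and each clause follows from the corresponding property of \<open>c\<close>.
  That the filter is nonempty is the density hypothesis for \<open>D = Field Q\<close>.
\<close>

lemma adds_generic_filterI:
  fixes r :: "'p rel" and Q :: "'a rel" and c :: "'a \<Rightarrow> 'p set"
  assumes refl_r: "\<And>p. p \<in> Field r \<Longrightarrow> (p, p) \<in> r" and trans_r: "trans r"
    and refl_Q: "\<And>a. a \<in> Field Q \<Longrightarrow> (a, a) \<in> Q"
    and down: "\<And>a p q. p \<in> c a \<Longrightarrow> (q, p) \<in> r \<Longrightarrow> q \<in> c a"
    and cond: "\<And>a p. p \<in> c a \<Longrightarrow> a \<in> Field Q"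
    and up: "\<And>a b p. p \<in> c a \<Longrightarrow> (a, b) \<in> Q \<Longrightarrow> p \<in> c b"
    and directed: "\<And>a b p. p \<in> c a \<Longrightarrow> p \<in> c b \<Longrightarrow> \<exists>z. p \<in> c z \<and> (z, a) \<in> Q \<and> (z, b) \<in> Q"
    and dense: "\<And>D p. dense_in Q D \<Longrightarrow> p \<in> Field r \<Longrightarrow> \<exists>a\<in>D. \<exists>t\<in>c a. (t, p) \<in> r"
  shows "adds_generic_filter r Q"
proof -
  let ?F = "ground_name c"
  have tr: "(s, p) \<in> r" if "(s, q) \<in> r" "(q, p) \<in> r" for s q p
    using trans_r that by (meson transD)
  have F1: "p \<in> Field r" "q \<in> Field r" if "(q, p) \<in> r" for p q
    using that by (auto simp: Field_def)
  have mem_F: "forces_mem r x ?F p \<longleftrightarrow> (\<exists>a. x = Urelem a \<and> dense_below r (\<lambda>t. t \<in> c a) p)"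
    if "p \<in> Field r" for x p
  proof -
    have "(\<exists>s\<in>c a. (t, s) \<in> r) \<longleftrightarrow> t \<in> c a" if "t \<in> Field r" for a t
      using down refl_r that by blast
    then have "forces_mem r x ?F p \<longleftrightarrow> dense_below r (\<lambda>t. \<exists>a. x = Urelem a \<and> t \<in> c a) p"
      unfolding forces_mem_ground_name by (intro dense_below_cong) simp
    also have "\<dots> \<longleftrightarrow> (\<exists>a. x = Urelem a \<and> dense_below r (\<lambda>t. t \<in> c a) p)"
      using refl_r[OF that] by (cases x) (auto simp: dense_below_def)
    finally show ?thesis .
  qed
  have mem_check: "forces_mem r x (check r A) p \<longleftrightarrow> (\<exists>a\<in>A. x = Urelem a)"
    if "p \<in> Field r" for x p A
  proof -
    have "(\<exists>s\<in>(if a \<in> A then Field r else {}). (t, s) \<in> r) \<longleftrightarrow> a \<in> A" if "t \<in> Field r" for a t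
      using refl_r that by auto
    then have "forces_mem r x (check r A) p \<longleftrightarrow> dense_below r (\<lambda>t. \<exists>a\<in>A. x = Urelem a) p"
      unfolding check_eq_ground_name forces_mem_ground_name by (intro dense_below_cong) auto
    also have "\<dots> \<longleftrightarrow> (\<exists>a\<in>A. x = Urelem a)"
      using refl_r F1 that unfolding dense_below_def by blast
    finally show ?thesis .
  qed
  have rel: "forces r (Ground_rel Q x y) p \<longleftrightarrow> (\<exists>a b. (a, b) \<in> Q \<and> x = Urelem a \<and> y = Urelem b)"
    if "p \<in> Field r" for x y p
    unfolding forces.simps dense_below_def forces_eq_Urelem using refl_r F1 that by blast
  have densely: "\<exists>t. (t, p) \<in> r \<and> t \<in> c a" if "dense_below r (\<lambda>t. t \<in> c a) p" "p \<in> Field r" for a p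
    using that refl_r by (auto simp: dense_below_def)
  have densely_mem: "forces_mem r (Urelem a) ?F p" if "p \<in> c a" "p \<in> Field r" for a p
    using that by (simp add: mem_F dense_below_def) (meson down F1 refl_r)
  have generic: "\<exists>a\<in>D. \<exists>t. (t, p) \<in> r \<and> forces_mem r (Urelem a) ?F t"
    if "dense_in Q D" "p \<in> Field r" for D p
    using dense[OF that] densely_mem F1 by blast
  have sub: "forces r (Forall (\<lambda>x. Implies (Mem x ?F) (Mem x (check r (Field Q))))) p"
    if "p \<in> Field r" for p
  proof -
    have "\<exists>t. (t, q) \<in> r \<and> forces_mem r x (check r (Field Q)) t"
      if q: "q \<in> Field r" and x: "forces_mem r x ?F q" for q x
    proof -
      obtain a where a: "x = Urelem a" "dense_below r (\<lambda>t. t \<in> c a) q"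
        using x by (auto simp: mem_F[OF q])
      obtain t where t: "(t, q) \<in> r" "t \<in> c a" using densely[OF a(2) q] by blast
      then have "forces_mem r x (check r (Field Q)) t"
        using a(1) cond by (auto simp: mem_check[OF F1(2)])
      then show ?thesis using t by blast
    qed
    then show ?thesis using F1 by (simp add: forces_Implies)
  qed
  have nonempty: "forces r (Exists (\<lambda>x. Mem x ?F)) p" if "p \<in> Field r" for p
  proof -
    have "dense_in Q (Field Q)" using refl_Q by (auto simp: dense_in_def)
    then show ?thesis
      using generic F1 by (simp add: forces_Exists dense_below_def) meson
  qed
  have upward: "forces r (Forall (\<lambda>x. Forall (\<lambda>y.
      Implies (And (Mem x ?F) (Ground_rel Q x y)) (Mem y ?F)))) p" if "p \<in> Field r" for p
  proof -
    have "\<exists>t. (t, q) \<in> r \<and> forces_mem r y ?F t"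
      if q: "q \<in> Field r" and x: "forces_mem r x ?F q" and xy: "forces r (Ground_rel Q x y) q" for q x y
    proof -
      obtain a b where "x = Urelem a" "y = Urelem b" "(a, b) \<in> Q"
          "dense_below r (\<lambda>t. t \<in> c a) q"
        using x xy by (auto simp: mem_F[OF q] rel[OF q] simp del: forces.simps)
      then show ?thesis using densely q up densely_mem F1 by meson
    qed
    then show ?thesis using F1 by (simp add: forces_Implies) blast
  qed
  have common: "forces r (Forall (\<lambda>x. Forall (\<lambda>y. Implies (And (Mem x ?F) (Mem y ?F))
      (Exists (\<lambda>z. And (Mem z ?F) (And (Ground_rel Q z x) (Ground_rel Q z y))))))) p"
    if "p \<in> Field r" for p
  proof -
    have "\<exists>z t. (t, q) \<in> r \<and> forces_mem r z ?F t \<and>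
        forces r (Ground_rel Q z x) t \<and> forces r (Ground_rel Q z y) t"
      if q: "q \<in> Field r" and x: "forces_mem r x ?F q" and y: "forces_mem r y ?F q" for q x y
    proof -
      obtain a b where ab: "x = Urelem a" "y = Urelem b"
          "dense_below r (\<lambda>t. t \<in> c a) q" "dense_below r (\<lambda>t. t \<in> c b) q"
        using x y by (auto simp: mem_F[OF q])
      obtain s where s: "(s, q) \<in> r" "s \<in> c a" using densely ab q by blast
      then obtain t where t: "(t, s) \<in> r" "t \<in> c b" using ab by (auto simp: dense_below_def)
      have "t \<in> c a" using s t down by blast
      then obtain z where "t \<in> c z" "(z, a) \<in> Q" "(z, b) \<in> Q" using directed t by blast
      then have "(t, q) \<in> r \<and> forces_mem r (Urelem z) ?F t \<and>
          forces r (Ground_rel Q (Urelem z) x) t \<and> forces r (Ground_rel Q (Urelem z) y) t"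
        using ab densely_mem[of t z] F1[OF t(1)] tr[OF t(1) s(1)] by (auto simp: rel simp del: forces.simps)
      then show ?thesis by blast
    qed
    note step = this
    have down_mem: "forces_mem r x ?F s" if "forces_mem r x ?F q" "(s, q) \<in> r" for x s q
      using that tr unfolding forces_mem_ground_name dense_below_def by blast
    have lower_bound: "forces r (Exists (\<lambda>z. And (Mem z ?F) (And (Ground_rel Q z x) (Ground_rel Q z y)))) q"
      if x: "forces_mem r x ?F q" and y: "forces_mem r y ?F q" for q x y
      unfolding forces_Exists dense_below_def
    proof (intro allI impI)
      fix s assume s: "(s, q) \<in> r"
      obtain z t where "(t, s) \<in> r" "forces_mem r z ?F t"
        "forces r (Ground_rel Q z x) t" "forces r (Ground_rel Q z y) t"
        using step[OF F1(2)[OF s] down_mem[OF x s] down_mem[OF y s]] by blast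
      then show "\<exists>t. (t, s) \<in> r \<and> (\<exists>z. forces r
          (And (Mem z ?F) (And (Ground_rel Q z x) (Ground_rel Q z y))) t)"
        by (auto simp del: forces.simps(3))
    qed
    show ?thesis
      unfolding forces.simps(2,5,6) forces_Implies
    proof (intro allI impI, elim conjE)
      fix x y q assume q: "(q, p) \<in> r" and x: "forces_mem r x ?F q" and y: "forces_mem r y ?F q"
      show "\<exists>t. (t, q) \<in> r \<and>
          forces r (Exists (\<lambda>z. And (Mem z ?F) (And (Ground_rel Q z x) (Ground_rel Q z y)))) t"
        using refl_r[OF F1(2)[OF q]] lower_bound[OF x y] by (rule exI[of _ q, OF conjI])
    qed
  qed
  have meets: "forces r (Forall_ground {D. dense_in Q D}
      (\<lambda>D. Exists (\<lambda>x. And (Mem x ?F) (Mem x D)))) p" if "p \<in> Field r" for p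
  proof -
    have "\<exists>t. (t, q) \<in> r \<and> (\<exists>x. forces_mem r x ?F t \<and> forces_mem r x (check r D) t)"
      if D: "dense_in Q D" and q: "q \<in> Field r" for D q
    proof -
      obtain a t where "a \<in> D" "(t, q) \<in> r" "forces_mem r (Urelem a) ?F t"
        using generic[OF D q] by blast
      then show ?thesis using mem_check[OF F1(2)] by blast
    qed
    then show ?thesis using F1 by (simp add: forces_Exists dense_below_def)
  qed
  have "forces r (is_generic_filter r Q ?F) p" if "p \<in> Field r" for p
    using sub[OF that] nonempty[OF that] upward[OF that] common[OF that] meets[OF that]
    unfolding is_generic_filter_def is_filter_def forces.simps(5) by blast
  then show ?thesis
    unfolding adds_generic_filter_def forces_Exists dense_below_def using refl_r F1 by blast
qed

section \<open>The measure of cylinders\<close>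

interpretation cantor: prob_space "cantor_measure \<kappa>" for \<kappa> :: "'k rel"
proof -
  interpret product_prob_space "\<lambda>_. uniform_count_measure (UNIV :: bool set)" "Field \<kappa> \<times> UNIV"
    by (intro product_prob_spaceI prob_space_uniform_count_measure) auto
  show "prob_space (cantor_measure \<kappa>)"
    unfolding cantor_measure_def by (rule prob_space_axioms)
qed

definition extensions :: "('i \<rightharpoonup> bool) \<Rightarrow> 'i set \<Rightarrow> ('i \<rightharpoonup> bool) set" where
  "extensions s E = {u. dom u = E \<and> s \<subseteq>\<^sub>m u}"

lemma finite_extensions: "finite E \<Longrightarrow> finite (extensions s E)"
  by (rule finite_subset[OF _ finite_set_of_finite_maps[of E UNIV]]) (auto simp: extensions_def)

lemma basic_open_measurable:
  "s \<in> Field (cohen_forcing \<kappa>) \<Longrightarrow> basic_open \<kappa> s \<in> sets (cantor_measure \<kappa>)"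
  by (simp add: sets_cantor_measure sigma_sets.Basic)

lemma measure_basic_open_cong:
  assumes "u \<in> Field (cohen_forcing \<kappa>)" "v \<in> Field (cohen_forcing \<kappa>)" "dom u = dom v"
  shows "measure (cantor_measure \<kappa>) (basic_open \<kappa> u) = measure (cantor_measure \<kappa>) (basic_open \<kappa> v)"
  by (simp add: measure_def emeasure_basic_open assms)

lemma basic_open_not_null:
  assumes "u \<in> Field (cohen_forcing \<kappa>)"
  shows "basic_open \<kappa> u \<notin> null_sets (cantor_measure \<kappa>)"
  using emeasure_basic_open[OF assms] by (auto simp: null_sets_def divide_ennreal_def)

lemma basic_open_antimono: "s \<subseteq>\<^sub>m u \<Longrightarrow> basic_open \<kappa> u \<subseteq> basic_open \<kappa> s"
  by (force simp: basic_open_def map_le_def)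

lemma measure_split_cylinder:
  assumes A: "A \<in> sets (cantor_measure \<kappa>)" and s: "dom s \<subseteq> E" and E: "finite E" "E \<subseteq> Field \<kappa> \<times> UNIV"
  shows "measure (cantor_measure \<kappa>) (A \<inter> basic_open \<kappa> s)
    = (\<Sum>u\<in>extensions s E. measure (cantor_measure \<kappa>) (A \<inter> basic_open \<kappa> u))"
proof -
  have union: "A \<inter> basic_open \<kappa> s = (\<Union>u\<in>extensions s E. A \<inter> basic_open \<kappa> u)"
  proof (intro equalityI subsetI)
    fix x assume x: "x \<in> A \<inter> basic_open \<kappa> s"
    let ?u = "\<lambda>i. if i \<in> E then Some (x i) else None"
    have "?u \<in> extensions s E" "x \<in> basic_open \<kappa> ?u"
      using x s by (auto simp: extensions_def basic_open_def map_le_def split: if_splits)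
    then show "x \<in> (\<Union>u\<in>extensions s E. A \<inter> basic_open \<kappa> u)" using x by blast
  qed (use basic_open_antimono in \<open>force simp: extensions_def\<close>)
  have disjoint: "disjoint_family_on (\<lambda>u. A \<inter> basic_open \<kappa> u) (extensions s E)"
    unfolding disjoint_family_on_def
  proof (intro ballI impI)
    fix u v assume uv: "u \<in> extensions s E" "v \<in> extensions s E" "u \<noteq> v"
    then obtain i where "u i \<noteq> v i" by blast
    moreover have "i \<in> dom u" "i \<in> dom v"
      using uv \<open>u i \<noteq> v i\<close> by (auto simp: extensions_def domIff)
    ultimately have "\<not> (x \<in> basic_open \<kappa> u \<and> x \<in> basic_open \<kappa> v)" for x
      unfolding basic_open_def mem_Collect_eq by metis
    then show "(A \<inter> basic_open \<kappa> u) \<inter> (A \<inter> basic_open \<kappa> v) = {}"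
      by blast
  qed
  have "A \<inter> basic_open \<kappa> u \<in> sets (cantor_measure \<kappa>)" if "u \<in> extensions s E" for u
    using that A E by (intro sets.Int basic_open_measurable) (auto simp: extensions_def Field_cohen_forcing)
  then show ?thesis
    unfolding union
    by (intro cantor.finite_measure_finite_Union finite_extensions E(1) disjoint) blast
qed

section \<open>Cylinders mostly filled by a set of positive measure\<close>

text \<open>
  The last clause says that membership in \<open>U\<close> depends only on the coordinates in \<open>E\<close>, so that \<open>U\<close> is
  a finite union of cylinders. This form makes the closure under Boolean operations immediate.
\<close>

definition clopen_over :: "'k rel \<Rightarrow> ('k \<times> nat) set \<Rightarrow> ('k \<times> nat \<Rightarrow> bool) set \<Rightarrow> bool" where
  "clopen_over \<kappa> E U \<longleftrightarrow> finite E \<and> E \<subseteq> Field \<kappa> \<times> UNIV \<and> U \<in> sets (cantor_measure \<kappa>) \<and>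
     (\<forall>x\<in>space (cantor_measure \<kappa>). \<forall>y\<in>U. (\<forall>i\<in>E. x i = y i) \<longrightarrow> x \<in> U)"

definition approximable :: "'k rel \<Rightarrow> ('k \<times> nat \<Rightarrow> bool) set \<Rightarrow> bool" where
  "approximable \<kappa> A \<longleftrightarrow> A \<in> sets (cantor_measure \<kappa>) \<and>
     (\<forall>\<epsilon>>0. \<exists>E U. clopen_over \<kappa> E U \<and> measure (cantor_measure \<kappa>) (sym_diff A U) < \<epsilon>)"

lemma clopen_over_Un:
  assumes U: "clopen_over \<kappa> E U" and U': "clopen_over \<kappa> E' U'"
  shows "clopen_over \<kappa> (E \<union> E') (U \<union> U')"
proof -
  have "x \<in> U \<union> U'"
    if x: "x \<in> space (cantor_measure \<kappa>)" and y: "y \<in> U \<union> U'" and eq: "\<forall>i\<in>E \<union> E'. x i = y i" for x y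
    using y
  proof
    assume "y \<in> U"
    moreover have "\<forall>i\<in>E. x i = y i" using eq by simp
    ultimately show ?thesis using U x unfolding clopen_over_def by blast
  next
    assume "y \<in> U'"
    moreover have "\<forall>i\<in>E'. x i = y i" using eq by simp
    ultimately show ?thesis using U' x unfolding clopen_over_def by blast
  qed
  then show ?thesis using U U' by (simp add: clopen_over_def sets.Un)
qed

lemma clopen_over_Compl:
  "clopen_over \<kappa> E U \<Longrightarrow> clopen_over \<kappa> E (space (cantor_measure \<kappa>) - U)"
  unfolding clopen_over_def by auto metis

lemma clopen_over_basic_open:
  "s \<in> Field (cohen_forcing \<kappa>) \<Longrightarrow> clopen_over \<kappa> (dom s) (basic_open \<kappa> s)"
  using basic_open_measurable[of s \<kappa>]
  by (auto simp: clopen_over_def Field_cohen_forcing) (auto simp: basic_open_def)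

lemma clopen_over_measurable: "clopen_over \<kappa> E U \<Longrightarrow> U \<in> sets (cantor_measure \<kappa>)"
  by (simp add: clopen_over_def)

lemma clopen_over_approximable: "clopen_over \<kappa> E U \<Longrightarrow> approximable \<kappa> U"
  unfolding approximable_def using clopen_over_measurable[of \<kappa> E U]
  by (intro conjI allI impI exI[of _ E] exI[of _ U]) simp_all

lemma approximable_empty: "approximable \<kappa> {}"
  by (rule clopen_over_approximable[of _ "{}"]) (simp add: clopen_over_def)

lemma approximable_Un:
  assumes "approximable \<kappa> A" "approximable \<kappa> B"
  shows "approximable \<kappa> (A \<union> B)"
  unfolding approximable_def
proof (intro conjI allI impI)
  let ?\<mu> = "measure (cantor_measure \<kappa>)"
  have AB [measurable]: "A \<in> sets (cantor_measure \<kappa>)" "B \<in> sets (cantor_measure \<kappa>)"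
    using assms by (auto simp: approximable_def)
  then show "A \<union> B \<in> sets (cantor_measure \<kappa>)" by blast
  fix \<epsilon> :: real assume "\<epsilon> > 0"
  then have "\<epsilon> / 2 > 0" by simp
  then obtain E U E' U' where U: "clopen_over \<kappa> E U" "?\<mu> (sym_diff A U) < \<epsilon> / 2"
      "clopen_over \<kappa> E' U'" "?\<mu> (sym_diff B U') < \<epsilon> / 2"
    using assms unfolding approximable_def by meson
  note [measurable] = clopen_over_measurable[OF U(1)] clopen_over_measurable[OF U(3)]
  have "?\<mu> (sym_diff (A \<union> B) (U \<union> U')) \<le> ?\<mu> (sym_diff A U \<union> sym_diff B U')"
    by (intro cantor.finite_measure_mono) auto
  also have "\<dots> \<le> ?\<mu> (sym_diff A U) + ?\<mu> (sym_diff B U')"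
    by (intro measure_Un_le) auto
  finally have "?\<mu> (sym_diff (A \<union> B) (U \<union> U')) < \<epsilon>" using U(2,4) by argo
  then show "\<exists>E U. clopen_over \<kappa> E U \<and> ?\<mu> (sym_diff (A \<union> B) U) < \<epsilon>"
    using clopen_over_Un[OF U(1,3)] by blast
qed

text \<open>
  The approximable sets form a \<open>\<sigma>\<close>-algebra containing the cylinders. A countable union is
  approximated by its finite partial unions, because the measure is finite.
\<close>

lemma measurable_approximable:
  assumes "A \<in> sets (cantor_measure \<kappa>)"
  shows "approximable \<kappa> A"
  using assms unfolding sets_cantor_measure
proof (induction rule: sigma_sets.induct)
  case (Basic A)
  then obtain s where "s \<in> Field (cohen_forcing \<kappa>)" "A = basic_open \<kappa> s" by blast
  then show ?case by (metis clopen_over_basic_open clopen_over_approximable)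
next
  case Empty
  show ?case by (rule approximable_empty)
next
  case (Compl A)
  let ?X = "space (cantor_measure \<kappa>)"
  let ?\<mu> = "measure (cantor_measure \<kappa>)"
  have A: "A \<in> sets (cantor_measure \<kappa>)" using Compl.IH by (simp add: approximable_def)
  show ?case
    unfolding approximable_def
  proof (intro conjI allI impI)
    show "?X - A \<in> sets (cantor_measure \<kappa>)" using A by blast
    fix \<epsilon> :: real assume "\<epsilon> > 0"
    then obtain E U where U: "clopen_over \<kappa> E U" "?\<mu> (sym_diff A U) < \<epsilon>"
      using Compl.IH unfolding approximable_def by blast
    have "sym_diff (?X - A) (?X - U) = sym_diff A U"
      using sets.sets_into_space[OF A] sets.sets_into_space[OF clopen_over_measurable[OF U(1)]] by blast
    then have "?\<mu> (sym_diff (?X - A) (?X - U)) < \<epsilon>" using U by simp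
    then show "\<exists>E U. clopen_over \<kappa> E U \<and> ?\<mu> (sym_diff (?X - A) U) < \<epsilon>"
      using clopen_over_Compl[OF U(1)] by blast
  qed
next
  case (Union A)
  let ?\<mu> = "measure (cantor_measure \<kappa>)"
  define B where "B n = (\<Union>i<n. A i)" for n
  have A_sets: "A i \<in> sets (cantor_measure \<kappa>)" for i
    using Union.IH by (auto simp: approximable_def)
  have B_approx: "approximable \<kappa> (B n)" for n
  proof (induction n)
    case 0
    show ?case unfolding B_def by (simp add: approximable_empty)
  next
    case (Suc n)
    have "B (Suc n) = A n \<union> B n" by (auto simp: B_def lessThan_Suc)
    then show ?case using approximable_Un[OF Union.IH[of n] Suc] by simp
  qed
  have B_sets: "B n \<in> sets (cantor_measure \<kappa>)" for n
    using B_approx by (auto simp: approximable_def)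
  have UB: "(\<Union>n. B n) = (\<Union>i. A i)" by (auto simp: B_def)
  show ?case
    unfolding approximable_def
  proof (intro conjI allI impI)
    show UA: "(\<Union>i. A i) \<in> sets (cantor_measure \<kappa>)" using A_sets by blast
    fix \<epsilon> :: real assume "\<epsilon> > 0"
    then have e2: "\<epsilon> / 2 > 0" by simp
    have "incseq B" unfolding B_def by (intro incseq_SucI UN_mono) auto
    then have lim: "(\<lambda>n. ?\<mu> (B n)) \<longlonglongrightarrow> ?\<mu> (\<Union>i. A i)"
      using cantor.finite_Lim_measure_incseq[of B \<kappa>] B_sets unfolding UB by (simp add: image_subset_iff)
    obtain n where n: "\<bar>?\<mu> (B n) - ?\<mu> (\<Union>i. A i)\<bar> < \<epsilon> / 2"
      using LIMSEQ_D[OF lim e2] by auto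
    obtain E U where U: "clopen_over \<kappa> E U" "?\<mu> (sym_diff (B n) U) < \<epsilon> / 2"
      using B_approx e2 unfolding approximable_def by blast
    have "?\<mu> (sym_diff (\<Union>i. A i) U) \<le> ?\<mu> (((\<Union>i. A i) - B n) \<union> sym_diff (B n) U)"
      using UA B_sets clopen_over_measurable[OF U(1)] UB
      by (intro cantor.finite_measure_mono sets.Un sets.Diff) auto
    also have "\<dots> \<le> ?\<mu> ((\<Union>i. A i) - B n) + ?\<mu> (sym_diff (B n) U)"
      using UA B_sets clopen_over_measurable[OF U(1)] by (intro measure_Un_le sets.Un sets.Diff)
    also have "?\<mu> ((\<Union>i. A i) - B n) = ?\<mu> (\<Union>i. A i) - ?\<mu> (B n)"
      using UA B_sets UB by (intro cantor.finite_measure_Diff) auto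
    finally have "?\<mu> (sym_diff (\<Union>i. A i) U) < \<epsilon>" using U n by argo
    then show "\<exists>E U. clopen_over \<kappa> E U \<and> ?\<mu> (sym_diff (\<Union>i. A i) U) < \<epsilon>"
      using U by blast
  qed
qed

definition majority :: "'k rel \<Rightarrow> ('k \<times> nat \<Rightarrow> bool) set \<Rightarrow> ('k \<times> nat \<rightharpoonup> bool) \<Rightarrow> bool" where
  "majority \<kappa> A u \<longleftrightarrow> u \<in> Field (cohen_forcing \<kappa>) \<and>
     measure (cantor_measure \<kappa>) (A \<inter> basic_open \<kappa> u) > measure (cantor_measure \<kappa>) (basic_open \<kappa> u) / 2"

text \<open>
  This is a replacement for the Lebesgue density theorem. Take a finite union \<open>U\<close> of cylinders on a
  finite set \<open>E\<close> of coordinates with \<open>A \<triangle> U\<close> of measure less than half that of \<open>A\<close>. If \<open>A\<close> filled at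
  most half of every cylinder on \<open>E\<close>, it would fill at most half of \<open>U\<close>. Then \<open>A \<inter> U\<close> has at most
  the measure of \<open>U - A\<close>, and \<open>A\<close> at most that of \<open>A \<triangle> U\<close>, a contradiction.
\<close>

lemma exists_majority_cylinder:
  assumes A: "A \<in> sets (cantor_measure \<kappa>)" and pos: "measure (cantor_measure \<kappa>) A > 0"
  obtains u where "majority \<kappa> A u"
proof -
  let ?\<mu> = "measure (cantor_measure \<kappa>)"
  obtain E U where U: "clopen_over \<kappa> E U" and near: "?\<mu> (sym_diff A U) < ?\<mu> A / 2"
    using measurable_approximable[OF A] half_gt_zero[OF pos] unfolding approximable_def by blast
  have E: "finite E" "E \<subseteq> Field \<kappa> \<times> UNIV" and Us: "U \<in> sets (cantor_measure \<kappa>)"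
    using U by (auto simp: clopen_over_def)
  let ?S = "extensions Map.empty E"
  have split: "?\<mu> B = (\<Sum>u\<in>?S. ?\<mu> (B \<inter> basic_open \<kappa> u))" if "B \<in> sets (cantor_measure \<kappa>)" for B
  proof -
    have "B \<inter> basic_open \<kappa> Map.empty = B"
      using sets.sets_into_space[OF that] by (auto simp: basic_open_def)
    then show ?thesis using measure_split_cylinder[OF that, of Map.empty E] E by simp
  qed
  have "\<exists>u\<in>?S. majority \<kappa> A u"
  proof (rule ccontr)
    assume none: "\<not> ?thesis"
    have "?\<mu> (A \<inter> U \<inter> basic_open \<kappa> u) \<le> ?\<mu> (U \<inter> basic_open \<kappa> u) / 2" if u: "u \<in> ?S" for u
    proof (cases "U \<inter> basic_open \<kappa> u = {}")
      case False
      then obtain y where y: "y \<in> U" "y \<in> basic_open \<kappa> u" by blast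
      have "basic_open \<kappa> u \<subseteq> U"
      proof
        fix x assume x: "x \<in> basic_open \<kappa> u"
        then have "\<forall>i\<in>E. x i = y i"
          using y u by (fastforce simp: basic_open_def extensions_def)
        moreover have "x \<in> space (cantor_measure \<kappa>)" using x by (simp add: basic_open_def)
        ultimately show "x \<in> U" using U y(1) unfolding clopen_over_def by blast
      qed
      \<comment> \<open>A cylinder on \<open>E\<close> is either disjoint from \<open>U\<close> or contained in it.\<close>
      then have "U \<inter> basic_open \<kappa> u = basic_open \<kappa> u" "A \<inter> U \<inter> basic_open \<kappa> u = A \<inter> basic_open \<kappa> u"
        by auto
      moreover have "u \<in> Field (cohen_forcing \<kappa>)"
        using u E by (auto simp: extensions_def Field_cohen_forcing)
      ultimately show ?thesis using none u by (auto simp: majority_def not_less)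
    qed (simp add: Int_assoc)
    then have half: "?\<mu> (A \<inter> U) \<le> ?\<mu> U / 2"
      unfolding split[OF sets.Int[OF A Us]] split[OF Us] sum_divide_distrib by (rule sum_mono)
    have "?\<mu> U = ?\<mu> (U - A) + ?\<mu> (A \<inter> U)"
      using cantor.finite_measure_Diff'[OF Us A] by (simp add: Int_commute)
    moreover have "?\<mu> A = ?\<mu> (A - U) + ?\<mu> (A \<inter> U)"
      using cantor.finite_measure_Diff'[OF A Us] by simp
    moreover have "?\<mu> (sym_diff A U) = ?\<mu> (A - U) + ?\<mu> (U - A)"
      using A Us by (intro cantor.finite_measure_Union) auto
    ultimately show False
      using half near measure_nonneg[of "cantor_measure \<kappa>" "A - U"]
        measure_nonneg[of "cantor_measure \<kappa>" "U - A"] by linarith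
  qed
  then show thesis using that by blast
qed

text \<open>
  The cylinders determined by the extensions of \<open>u\<close> to \<open>E\<close> partition that of \<open>u\<close>, so one of them
  inherits the majority. This is what makes it possible to give the cylinders for two sets a common
  domain.
\<close>

lemma majority_extend:
  assumes A: "A \<in> sets (cantor_measure \<kappa>)" and u: "majority \<kappa> A u"
    and E: "dom u \<subseteq> E" "finite E" "E \<subseteq> Field \<kappa> \<times> UNIV"
  obtains v where "v \<in> extensions u E" "majority \<kappa> A v"
proof -
  let ?\<mu> = "measure (cantor_measure \<kappa>)"
  have ext: "v \<in> Field (cohen_forcing \<kappa>)" if "v \<in> extensions u E" for v
    using that E by (auto simp: extensions_def Field_cohen_forcing)
  have Xu: "space (cantor_measure \<kappa>) \<inter> basic_open \<kappa> v = basic_open \<kappa> v" for v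
    by (auto simp: basic_open_def)
  have "\<exists>v\<in>extensions u E. majority \<kappa> A v"
  proof (rule ccontr)
    assume "\<not> ?thesis"
    then have "?\<mu> (A \<inter> basic_open \<kappa> v) \<le> ?\<mu> (basic_open \<kappa> v) / 2" if "v \<in> extensions u E" for v
      using that ext by (auto simp: majority_def not_less)
    then have "?\<mu> (A \<inter> basic_open \<kappa> u) \<le> ?\<mu> (basic_open \<kappa> u) / 2"
      unfolding measure_split_cylinder[OF A E]
      using measure_split_cylinder[OF sets.top E, unfolded Xu]
      by (simp add: sum_divide_distrib sum_mono)
    then show False using u by (simp add: majority_def)
  qed
  then show thesis using that by blast
qed

section \<open>The sum of two sets of positive measure\<close>

text \<open>
  Addition modulo \<open>2\<close> of finite partial functions: if \<open>x\<close> extends \<open>u\<close> and \<open>y\<close> extends \<open>v\<close>, then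
  \<open>xor_map u v\<close> is the part of \<open>x + y\<close> that is determined by this.
\<close>

definition xor_map :: "('i \<rightharpoonup> bool) \<Rightarrow> ('i \<rightharpoonup> bool) \<Rightarrow> ('i \<rightharpoonup> bool)" where
  "xor_map u v = (\<lambda>i. case (u i, v i) of (Some a, Some b) \<Rightarrow> Some (a \<noteq> b) | _ \<Rightarrow> None)"

lemma dom_xor_map: "dom (xor_map u v) = dom u \<inter> dom v"
  by (auto simp: xor_map_def dom_def split: option.splits)

lemma xor_map_cancel: "dom u \<subseteq> dom t \<Longrightarrow> xor_map t (xor_map t u) = u"
proof
  fix i assume "dom u \<subseteq> dom t"
  then have "i \<in> dom u \<Longrightarrow> i \<in> dom t" by blast
  then show "xor_map t (xor_map t u) i = u i"
    by (cases "u i"; cases "t i") (auto simp: xor_map_def)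
qed

lemma xor_map_commute: "xor_map u v = xor_map v u"
  by (rule ext) (auto simp: xor_map_def split: option.splits)

lemma xor_map_mono: "u \<subseteq>\<^sub>m u' \<Longrightarrow> v \<subseteq>\<^sub>m v' \<Longrightarrow> xor_map u v \<subseteq>\<^sub>m xor_map u' v'"
  by (fastforce simp: map_le_def xor_map_def dom_def split: option.splits)

lemma xor_map_restrict: "xor_map (u |` E) (v |` E) = xor_map u v |` E"
  by (rule ext) (simp add: xor_map_def restrict_map_def)

lemma xor_map_bij_betw_extensions:
  assumes "dom u = dom v" "xor_map u v \<subseteq>\<^sub>m t"
  shows "bij_betw (xor_map t) (extensions u (dom t)) (extensions v (dom t))"
proof (rule bij_betw_byWitness[where f' = "xor_map t"])
  have uv: "xor_map (xor_map u v) u = v" "xor_map (xor_map u v) v = u"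
    using assms(1) xor_map_cancel[of v u] xor_map_cancel[of u v]
    by (metis order_refl xor_map_commute)+
  show "\<forall>a\<in>extensions u (dom t). xor_map t (xor_map t a) = a"
    by (auto simp: extensions_def xor_map_cancel)
  show "\<forall>a\<in>extensions v (dom t). xor_map t (xor_map t a) = a"
    by (auto simp: extensions_def xor_map_cancel)
  have "v \<subseteq>\<^sub>m xor_map t a" if "u \<subseteq>\<^sub>m a" for a
    using xor_map_mono[OF assms(2) that] uv by simp
  then show "xor_map t ` extensions u (dom t) \<subseteq> extensions v (dom t)"
    unfolding extensions_def image_subset_iff mem_Collect_eq dom_xor_map by blast
  have "u \<subseteq>\<^sub>m xor_map t a" if "v \<subseteq>\<^sub>m a" for a
    using xor_map_mono[OF assms(2) that] uv by simp
  then show "xor_map t ` extensions v (dom t) \<subseteq> extensions u (dom t)"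
    unfolding extensions_def image_subset_iff mem_Collect_eq dom_xor_map by blast
qed

text \<open>
  The combinatorial core, a pigeonhole argument in terms of measures: \<open>A\<close> and \<open>B\<close> fill more than half
  of \<open>[u0]\<close> and \<open>[v0]\<close> respectively, so among the pairs \<open>(u, t + u)\<close> of extensions there is one with
  \<open>A \<inter> [u]\<close> and \<open>B \<inter> [t + u]\<close> both of positive measure.
\<close>

lemma sum_meets_dense:
  assumes A: "A \<in> sets (cantor_measure \<kappa>)" "measure (cantor_measure \<kappa>) A > 0"
    and B: "B \<in> sets (cantor_measure \<kappa>)" "measure (cantor_measure \<kappa>) B > 0"
    and D: "dense_in (cohen_forcing \<kappa>) D"
  obtains u v where "u \<in> Field (cohen_forcing \<kappa>)" "dom v = dom u" "xor_map u v \<in> D"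
    "measure (cantor_measure \<kappa>) (A \<inter> basic_open \<kappa> u) > 0"
    "measure (cantor_measure \<kappa>) (B \<inter> basic_open \<kappa> v) > 0"
proof -
  let ?\<mu> = "measure (cantor_measure \<kappa>)"
  obtain u1 where u1: "majority \<kappa> A u1" using exists_majority_cylinder[OF A] .
  obtain v1 where v1: "majority \<kappa> B v1" using exists_majority_cylinder[OF B] .
  let ?E = "dom u1 \<union> dom v1"
  have E: "finite ?E" "?E \<subseteq> Field \<kappa> \<times> UNIV"
    using u1 v1 by (auto simp: majority_def Field_cohen_forcing)
  obtain u0 where u0: "u0 \<in> extensions u1 ?E" "majority \<kappa> A u0"
    using majority_extend[OF A(1) u1 _ E] by blast
  obtain v0 where v0: "v0 \<in> extensions v1 ?E" "majority \<kappa> B v0"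
    using majority_extend[OF B(1) v1 _ E] by blast
  have dom0: "dom u0 = ?E" "dom v0 = ?E" using u0 v0 by (auto simp: extensions_def)
  then have "xor_map u0 v0 \<in> Field (cohen_forcing \<kappa>)"
    using E by (simp add: Field_cohen_forcing dom_xor_map)
  then obtain t where t: "t \<in> D" "(t, xor_map u0 v0) \<in> cohen_forcing \<kappa>"
    using D by (auto simp: dense_in_def)
  then have t': "finite (dom t)" "dom t \<subseteq> Field \<kappa> \<times> UNIV" "xor_map u0 v0 \<subseteq>\<^sub>m t"
    by (auto simp: cohen_forcing_def)
  then have sub: "dom u0 \<subseteq> dom t" "dom v0 \<subseteq> dom t"
    using map_le_implies_dom_le[OF t'(3)] dom0 by (auto simp: dom_xor_map)
  have ext: "u \<in> Field (cohen_forcing \<kappa>)" if "dom u = dom t" for u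
    using that t' by (auto simp: Field_cohen_forcing)
  have "\<exists>u\<in>extensions u0 (dom t).
      ?\<mu> (A \<inter> basic_open \<kappa> u) > 0 \<and> ?\<mu> (B \<inter> basic_open \<kappa> (xor_map t u)) > 0"
  proof (rule ccontr)
    assume none: "\<not> ?thesis"
    \<comment> \<open>One summand vanishes, and the two cylinders have the same measure.\<close>
    have le: "?\<mu> (A \<inter> basic_open \<kappa> u) + ?\<mu> (B \<inter> basic_open \<kappa> (xor_map t u)) \<le> ?\<mu> (basic_open \<kappa> u)"
      if u: "u \<in> extensions u0 (dom t)" for u
    proof -
      have d: "dom u = dom t" "dom (xor_map t u) = dom t" using u by (auto simp: extensions_def dom_xor_map)
      have "?\<mu> (C \<inter> basic_open \<kappa> w) \<le> ?\<mu> (basic_open \<kappa> u)" if "dom w = dom t" for C w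
      proof -
        have "?\<mu> (C \<inter> basic_open \<kappa> w) \<le> ?\<mu> (basic_open \<kappa> w)"
          using basic_open_measurable[OF ext[OF that]] by (intro cantor.finite_measure_mono) auto
        also have "\<dots> = ?\<mu> (basic_open \<kappa> u)" by (intro measure_basic_open_cong ext) (simp_all add: that d)
        finally show ?thesis .
      qed
      then show ?thesis
        using none u d by (metis add.commute add_0 measure_le_0_iff not_less)
    qed
    have Xu: "space (cantor_measure \<kappa>) \<inter> basic_open \<kappa> v = basic_open \<kappa> v" for v
      by (auto simp: basic_open_def)
    have "?\<mu> (A \<inter> basic_open \<kappa> u0) + ?\<mu> (B \<inter> basic_open \<kappa> v0)
        = (\<Sum>u\<in>extensions u0 (dom t). ?\<mu> (A \<inter> basic_open \<kappa> u) + ?\<mu> (B \<inter> basic_open \<kappa> (xor_map t u)))"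
      unfolding measure_split_cylinder[OF A(1) sub(1) t'(1,2)] measure_split_cylinder[OF B(1) sub(2) t'(1,2)]
      using sum.reindex_bij_betw[OF xor_map_bij_betw_extensions[of u0 v0 t],
          of "\<lambda>v. ?\<mu> (B \<inter> basic_open \<kappa> v)"] dom0 t'(3)
      by (simp add: sum.distrib)
    also have "\<dots> \<le> (\<Sum>u\<in>extensions u0 (dom t). ?\<mu> (basic_open \<kappa> u))"
      by (intro sum_mono le)
    also have "\<dots> = ?\<mu> (basic_open \<kappa> u0)"
      using measure_split_cylinder[OF sets.top sub(1) t'(1,2), unfolded Xu] by simp
    finally have "?\<mu> (A \<inter> basic_open \<kappa> u0) + ?\<mu> (B \<inter> basic_open \<kappa> v0) \<le> ?\<mu> (basic_open \<kappa> u0)" .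
    moreover have "?\<mu> (basic_open \<kappa> v0) = ?\<mu> (basic_open \<kappa> u0)"
      using u0 v0 dom0 by (intro measure_basic_open_cong) (simp_all add: majority_def)
    ultimately show False using u0 v0 by (simp add: majority_def)
  qed
  then obtain u where u: "u \<in> extensions u0 (dom t)" "?\<mu> (A \<inter> basic_open \<kappa> u) > 0"
      "?\<mu> (B \<inter> basic_open \<kappa> (xor_map t u)) > 0" by blast
  have du: "dom u = dom t" using u by (simp add: extensions_def)
  show thesis
  proof (rule that[of u "xor_map t u"])
    have "xor_map u (xor_map t u) = t"
      using xor_map_cancel[of t u] du by (simp add: xor_map_commute[of t])
    then show "xor_map u (xor_map t u) \<in> D" using t by simp
  qed (use u du ext in \<open>auto simp: dom_xor_map\<close>)
qed

section \<open>Random conditions in terms of representatives\<close>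

lemma equiv_null_equiv: "equiv (sets (cantor_measure \<kappa>)) (null_equiv \<kappa>)"
proof (rule equivI)
  show "null_equiv \<kappa> \<subseteq> sets (cantor_measure \<kappa>) \<times> sets (cantor_measure \<kappa>)"
    by (auto simp: null_equiv_def)
  show "refl_on (sets (cantor_measure \<kappa>)) (null_equiv \<kappa>)"
    by (auto simp: null_equiv_def refl_on_def)
  show "sym (null_equiv \<kappa>)"
    by (auto simp: null_equiv_def sym_def Un_commute)
  show "trans (null_equiv \<kappa>)"
  proof (rule transI)
    fix S T U assume "(S, T) \<in> null_equiv \<kappa>" "(T, U) \<in> null_equiv \<kappa>"
    then have sets: "S \<in> sets (cantor_measure \<kappa>)" "U \<in> sets (cantor_measure \<kappa>)"
      and "sym_diff S T \<union> sym_diff T U \<in> null_sets (cantor_measure \<kappa>)"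
      unfolding null_equiv_def by blast+
    then have "sym_diff S U \<in> null_sets (cantor_measure \<kappa>)"
      by (rule_tac null_sets_subset[of "sym_diff S T \<union> sym_diff T U"]) auto
    then show "(S, U) \<in> null_equiv \<kappa>" using sets by (simp add: null_equiv_def)
  qed
qed

lemma class_random_condition_iff:
  assumes "S \<in> sets (cantor_measure \<kappa>)"
  shows "null_equiv \<kappa> `` {S} \<in> random_conditions \<kappa> \<longleftrightarrow> S \<notin> null_sets (cantor_measure \<kappa>)"
proof -
  have "null_equiv \<kappa> `` {S} = null_equiv \<kappa> `` {{}} \<longleftrightarrow> (S, {}) \<in> null_equiv \<kappa>"
    using eq_equiv_class_iff[OF equiv_null_equiv assms] by simp
  also have "\<dots> \<longleftrightarrow> S \<in> null_sets (cantor_measure \<kappa>)"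
    using assms by (auto simp: null_equiv_def)
  finally show ?thesis
    using assms by (simp add: random_conditions_def quotientI)
qed

lemma random_condition_cases:
  assumes "P \<in> random_conditions \<kappa>"
  obtains S where "P = null_equiv \<kappa> `` {S}" "S \<in> sets (cantor_measure \<kappa>)"
    "S \<notin> null_sets (cantor_measure \<kappa>)"
proof -
  obtain S where "P = null_equiv \<kappa> `` {S}" "S \<in> sets (cantor_measure \<kappa>)"
    using assms by (auto simp: random_conditions_def elim: quotientE)
  then show thesis using that assms class_random_condition_iff by blast
qed

lemma random_forcing_class_iff:
  assumes S: "S \<in> sets (cantor_measure \<kappa>)" and T: "T \<in> sets (cantor_measure \<kappa>)"
  shows "(null_equiv \<kappa> `` {S}, null_equiv \<kappa> `` {T}) \<in> random_forcing \<kappa> \<longleftrightarrow>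
    S \<notin> null_sets (cantor_measure \<kappa>) \<and> T \<notin> null_sets (cantor_measure \<kappa>) \<and>
    S - T \<in> null_sets (cantor_measure \<kappa>)"
proof -
  let ?M = "cantor_measure \<kappa>"
  have "S - T \<in> null_sets ?M"
    if "S' \<in> null_equiv \<kappa> `` {S}" "T' \<in> null_equiv \<kappa> `` {T}" "emeasure ?M (S' - T') = 0" for S' T'
  proof -
    have "sym_diff S S' \<in> null_sets ?M" "sym_diff T T' \<in> null_sets ?M" "S' - T' \<in> null_sets ?M"
      using that by (auto simp: null_equiv_def)
    then have "sym_diff S S' \<union> sym_diff T T' \<union> (S' - T') \<in> null_sets ?M" by blast
    then show ?thesis using S T by (rule_tac null_sets_subset) auto
  qed
  moreover have "S \<in> null_equiv \<kappa> `` {S}" "T \<in> null_equiv \<kappa> `` {T}"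
    using S T by (auto simp: null_equiv_def)
  ultimately have "(\<exists>S'\<in>null_equiv \<kappa> `` {S}. \<exists>T'\<in>null_equiv \<kappa> `` {T}. emeasure ?M (S' - T') = 0)
      \<longleftrightarrow> S - T \<in> null_sets ?M"
    by (meson null_setsD1)
  then show ?thesis
    using class_random_condition_iff[OF S] class_random_condition_iff[OF T]
    by (simp add: random_forcing_def)
qed

lemma random_forcing_refl: "P \<in> random_conditions \<kappa> \<Longrightarrow> (P, P) \<in> random_forcing \<kappa>"
  by (erule random_condition_cases) (simp add: random_forcing_class_iff)

lemma trans_random_forcing: "trans (random_forcing \<kappa>)"
proof (rule transI)
  fix P Q R assume PQ: "(P, Q) \<in> random_forcing \<kappa>" and QR: "(Q, R) \<in> random_forcing \<kappa>"
  then have "P \<in> random_conditions \<kappa>" "Q \<in> random_conditions \<kappa>" "R \<in> random_conditions \<kappa>"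
    by (auto simp: random_forcing_def)
  then obtain S T U where
    S: "P = null_equiv \<kappa> `` {S}" "S \<in> sets (cantor_measure \<kappa>)" and
    T: "Q = null_equiv \<kappa> `` {T}" "T \<in> sets (cantor_measure \<kappa>)" and
    U: "R = null_equiv \<kappa> `` {U}" "U \<in> sets (cantor_measure \<kappa>)"
    by (meson random_condition_cases)
  then have "(S - T) \<union> (T - U) \<in> null_sets (cantor_measure \<kappa>)"
    using PQ QR by (auto simp: random_forcing_class_iff)
  then have "S - U \<in> null_sets (cantor_measure \<kappa>)"
    by (rule null_sets_subset) (use S U in auto)
  then show "(P, R) \<in> random_forcing \<kappa>"
    using PQ QR S T U by (simp add: random_forcing_class_iff)
qed

text \<open>\<open>P\<close> forces the random point to extend \<open>u\<close>.\<close>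

definition extends_in_random :: "'k rel \<Rightarrow> ('k \<times> nat \<rightharpoonup> bool) \<Rightarrow> ('k \<times> nat \<Rightarrow> bool) set set \<Rightarrow> bool" where
  "extends_in_random \<kappa> u P \<longleftrightarrow> u \<in> Field (cohen_forcing \<kappa>) \<and>
     (P, null_equiv \<kappa> `` {basic_open \<kappa> u}) \<in> random_forcing \<kappa>"

lemma extends_in_random_class_iff:
  assumes "S \<in> sets (cantor_measure \<kappa>)" "u \<in> Field (cohen_forcing \<kappa>)"
  shows "extends_in_random \<kappa> u (null_equiv \<kappa> `` {S}) \<longleftrightarrow>
    S \<notin> null_sets (cantor_measure \<kappa>) \<and> S - basic_open \<kappa> u \<in> null_sets (cantor_measure \<kappa>)"
  using assms basic_open_not_null
  by (auto simp: extends_in_random_def random_forcing_class_iff basic_open_measurable)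

lemma extends_in_random_cases:
  assumes "extends_in_random \<kappa> u P"
  obtains S where "P = null_equiv \<kappa> `` {S}" "S \<in> sets (cantor_measure \<kappa>)"
    "S \<notin> null_sets (cantor_measure \<kappa>)" "S - basic_open \<kappa> u \<in> null_sets (cantor_measure \<kappa>)"
    "u \<in> Field (cohen_forcing \<kappa>)"
proof -
  have "P \<in> random_conditions \<kappa>" "u \<in> Field (cohen_forcing \<kappa>)"
    using assms by (auto simp: extends_in_random_def random_forcing_def)
  then show thesis
    using that assms by (metis random_condition_cases extends_in_random_class_iff)
qed

lemma extends_in_random_stronger:
  "extends_in_random \<kappa> u P \<Longrightarrow> (P', P) \<in> random_forcing \<kappa> \<Longrightarrow> extends_in_random \<kappa> u P'"
  using trans_random_forcing by (auto simp: extends_in_random_def dest: transD)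

lemma extends_in_random_restrict:
  assumes "extends_in_random \<kappa> u P"
  shows "extends_in_random \<kappa> (u |` E) P"
  using assms
proof (rule extends_in_random_cases)
  fix S assume S: "P = null_equiv \<kappa> `` {S}" "S \<in> sets (cantor_measure \<kappa>)"
    "S \<notin> null_sets (cantor_measure \<kappa>)" "S - basic_open \<kappa> u \<in> null_sets (cantor_measure \<kappa>)"
    and u: "u \<in> Field (cohen_forcing \<kappa>)"
  have uE: "u |` E \<in> Field (cohen_forcing \<kappa>)"
    using u by (auto simp: Field_cohen_forcing)
  have "basic_open \<kappa> u \<subseteq> basic_open \<kappa> (u |` E)"
    by (rule basic_open_antimono) (simp add: map_le_def)
  then have "S - basic_open \<kappa> (u |` E) \<in> null_sets (cantor_measure \<kappa>)"
    using S uE by (intro null_sets_subset[OF S(4)] sets.Diff basic_open_measurable) auto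
  then show ?thesis using S uE by (simp add: extends_in_random_class_iff)
qed

text \<open>
  Two finite functions that one nonzero condition forces the random point to extend are compatible:
  almost every point of a representative lies in both cylinders, so they share a point.
\<close>

lemma extends_in_random_union:
  assumes "extends_in_random \<kappa> u P" "extends_in_random \<kappa> u' P"
  obtains "u \<subseteq>\<^sub>m u ++ u'" "u' \<subseteq>\<^sub>m u ++ u'" "extends_in_random \<kappa> (u ++ u') P"
proof -
  let ?M = "cantor_measure \<kappa>"
  obtain S where S: "P = null_equiv \<kappa> `` {S}" "S \<in> sets ?M" "S \<notin> null_sets ?M"
    "S - basic_open \<kappa> u \<in> null_sets ?M" and u: "u \<in> Field (cohen_forcing \<kappa>)"
    using assms(1) by (rule extends_in_random_cases)
  have u': "u' \<in> Field (cohen_forcing \<kappa>)" using assms(2) by (simp add: extends_in_random_def)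
  have S': "S - basic_open \<kappa> u' \<in> null_sets ?M"
    using assms(2) S u' by (simp add: extends_in_random_class_iff)
  have "S \<inter> basic_open \<kappa> u \<inter> basic_open \<kappa> u' \<noteq> {}"
  proof
    assume "S \<inter> basic_open \<kappa> u \<inter> basic_open \<kappa> u' = {}"
    then have "S = (S - basic_open \<kappa> u) \<union> (S - basic_open \<kappa> u')" by blast
    then show False using S S' by (metis null_sets.Un)
  qed
  then obtain x where x: "x \<in> basic_open \<kappa> u" "x \<in> basic_open \<kappa> u'" by blast
  have agree: "u i = u' i" if "i \<in> dom u" "i \<in> dom u'" for i
    using x that by (auto simp: basic_open_def)
  have w: "u ++ u' \<in> Field (cohen_forcing \<kappa>)"
    using u u' by (auto simp: Field_cohen_forcing)
  have "basic_open \<kappa> u \<inter> basic_open \<kappa> u' \<subseteq> basic_open \<kappa> (u ++ u')"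
  proof
    fix x assume x: "x \<in> basic_open \<kappa> u \<inter> basic_open \<kappa> u'"
    have "(u ++ u') i = Some (x i)" if "i \<in> dom (u ++ u')" for i
    proof (cases "i \<in> dom u'")
      case True
      then show ?thesis using x by (simp add: basic_open_def map_add_dom_app_simps(1))
    next
      case False
      then have "i \<in> dom u" using that by auto
      then show ?thesis using x False by (simp add: basic_open_def map_add_dom_app_simps(3))
    qed
    then show "x \<in> basic_open \<kappa> (u ++ u')" using x by (simp add: basic_open_def)
  qed
  then have "S - basic_open \<kappa> (u ++ u') \<in> null_sets ?M"
    using S w by (intro null_sets_subset[OF null_sets.Un[OF S(4) S']] sets.Diff basic_open_measurable) auto
  then have "extends_in_random \<kappa> (u ++ u') P"
    using S w by (simp add: extends_in_random_class_iff)
  moreover have "u \<subseteq>\<^sub>m u ++ u'"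
    unfolding map_le_def
  proof
    fix i assume "i \<in> dom u"
    then show "u i = (u ++ u') i"
      using agree[of i] by (cases "i \<in> dom u'") (simp_all add: map_add_dom_app_simps)
  qed
  ultimately show thesis using that by simp
qed

section \<open>The sum of the two random points\<close>

text \<open>
  The conditions that decide the two random points on the domain of \<open>a\<close>, in such a way that their sum
  extends \<open>a\<close>. With both decided, rather than only their sum, two such conditions for \<open>a\<close> and \<open>b\<close>
  directly determine a common extension of \<open>a\<close> and \<open>b\<close>.
\<close>

definition sum_conditions ::
    "'k rel \<Rightarrow> ('k \<times> nat \<rightharpoonup> bool) \<Rightarrow> (('k \<times> nat \<Rightarrow> bool) set set \<times> ('k \<times> nat \<Rightarrow> bool) set set) set" where
  "sum_conditions \<kappa> a = {(P, Q). \<exists>u v. dom v = dom u \<and> a = xor_map u v \<and>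
     extends_in_random \<kappa> u P \<and> extends_in_random \<kappa> v Q}"

lemma sum_conditionsI:
  "dom v = dom u \<Longrightarrow> extends_in_random \<kappa> u P \<Longrightarrow> extends_in_random \<kappa> v Q \<Longrightarrow>
    (P, Q) \<in> sum_conditions \<kappa> (xor_map u v)"
  unfolding sum_conditions_def by blast

lemma sum_conditionsE:
  assumes "p \<in> sum_conditions \<kappa> a"
  obtains P Q u v where "p = (P, Q)" "dom v = dom u" "a = xor_map u v"
    "extends_in_random \<kappa> u P" "extends_in_random \<kappa> v Q"
  using assms unfolding sum_conditions_def by blast

theorem theorem1p4:
  fixes \<kappa> :: "'k rel"
  assumes "Cinfinite \<kappa>"
  shows "adds_generic_filter (product_forcing (random_forcing \<kappa>) (random_forcing \<kappa>)) (cohen_forcing \<kappa>)"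
proof (rule adds_generic_filterI[where c = "sum_conditions \<kappa>"])
  let ?r = "product_forcing (random_forcing \<kappa>) (random_forcing \<kappa>)"
  have Field_r: "P \<in> random_conditions \<kappa>" "Q \<in> random_conditions \<kappa>" if "(P, Q) \<in> Field ?r" for P Q
    using that by (auto simp: product_forcing_def Field_def random_forcing_def)
  show "(p, p) \<in> ?r" if "p \<in> Field ?r" for p
    using Field_r that by (cases p) (simp add: product_forcing_def random_forcing_refl)
  show "trans ?r"
    using trans_random_forcing[of \<kappa>] unfolding trans_def product_forcing_def by blast
  show "(a, a) \<in> cohen_forcing \<kappa>" if "a \<in> Field (cohen_forcing \<kappa>)" for a
    using that unfolding Field_cohen_forcing by (simp add: cohen_forcing_def)
  show "q \<in> sum_conditions \<kappa> a" if a: "p \<in> sum_conditions \<kappa> a" and qp: "(q, p) \<in> ?r" for a p q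
  proof -
    obtain P Q u v where p: "p = (P, Q)" and uv: "dom v = dom u" "a = xor_map u v"
      "extends_in_random \<kappa> u P" "extends_in_random \<kappa> v Q"
      using a by (rule sum_conditionsE)
    obtain P' Q' where q: "q = (P', Q')"
      and le: "(P', P) \<in> random_forcing \<kappa>" "(Q', Q) \<in> random_forcing \<kappa>"
      using qp p by (auto simp: product_forcing_def)
    show ?thesis
      unfolding q uv(2)
      by (intro sum_conditionsI uv(1) extends_in_random_stronger[OF uv(3) le(1)]
          extends_in_random_stronger[OF uv(4) le(2)])
  qed
  show "a \<in> Field (cohen_forcing \<kappa>)" if "p \<in> sum_conditions \<kappa> a" for a p
    using that by (rule sum_conditionsE) (auto simp: extends_in_random_def Field_cohen_forcing dom_xor_map)
  show "p \<in> sum_conditions \<kappa> b" if p: "p \<in> sum_conditions \<kappa> a" and ab: "(a, b) \<in> cohen_forcing \<kappa>" for a b p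
  proof -
    obtain P Q u v where PQ: "p = (P, Q)" and uv: "dom v = dom u" "a = xor_map u v"
      "extends_in_random \<kappa> u P" "extends_in_random \<kappa> v Q"
      using p by (rule sum_conditionsE)
    have ba: "b \<subseteq>\<^sub>m a" using ab by (simp add: cohen_forcing_def)
    have "xor_map u v |` dom b = b"
    proof
      fix i show "(xor_map u v |` dom b) i = b i"
        using ba by (cases "i \<in> dom b") (auto simp: map_le_def restrict_map_def uv(2) domIff)
    qed
    then have b: "b = xor_map (u |` dom b) (v |` dom b)" by (simp add: xor_map_restrict)
    have "p \<in> sum_conditions \<kappa> (xor_map (u |` dom b) (v |` dom b))"
      unfolding PQ by (intro sum_conditionsI extends_in_random_restrict uv) (simp add: uv(1))
    then show ?thesis by (simp flip: b)
  qed
  show "\<exists>z. p \<in> sum_conditions \<kappa> z \<and> (z, a) \<in> cohen_forcing \<kappa> \<and> (z, b) \<in> cohen_forcing \<kappa>"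
    if a: "p \<in> sum_conditions \<kappa> a" and b: "p \<in> sum_conditions \<kappa> b" for a b p
  proof -
    obtain P Q u v where PQ: "p = (P, Q)" and uv: "dom v = dom u" "a = xor_map u v"
      "extends_in_random \<kappa> u P" "extends_in_random \<kappa> v Q"
      using a by (rule sum_conditionsE)
    obtain u' v' where uv': "dom v' = dom u'" "b = xor_map u' v'"
      "extends_in_random \<kappa> u' P" "extends_in_random \<kappa> v' Q"
      using b unfolding PQ by (auto elim: sum_conditionsE)
    let ?z = "xor_map (u ++ u') (v ++ v')"
    have U: "u \<subseteq>\<^sub>m u ++ u'" "u' \<subseteq>\<^sub>m u ++ u'" "extends_in_random \<kappa> (u ++ u') P"
      using extends_in_random_union[OF uv(3) uv'(3)] by blast+
    have V: "v \<subseteq>\<^sub>m v ++ v'" "v' \<subseteq>\<^sub>m v ++ v'" "extends_in_random \<kappa> (v ++ v') Q"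
      using extends_in_random_union[OF uv(4) uv'(4)] by blast+
    have "p \<in> sum_conditions \<kappa> ?z"
      unfolding PQ by (intro sum_conditionsI U(3) V(3)) (simp add: uv(1) uv'(1))
    moreover have "finite (dom ?z)" "dom ?z \<subseteq> Field \<kappa> \<times> UNIV"
      using U by (auto simp: extends_in_random_def Field_cohen_forcing dom_xor_map)
    moreover have "a \<subseteq>\<^sub>m ?z" "b \<subseteq>\<^sub>m ?z"
      using U V uv uv' by (simp_all add: xor_map_mono)
    ultimately show ?thesis by (auto simp: cohen_forcing_def)
  qed
  show "\<exists>a\<in>D. \<exists>t\<in>sum_conditions \<kappa> a. (t, p) \<in> ?r"
    if D: "dense_in (cohen_forcing \<kappa>) D" and p: "p \<in> Field ?r" for D p
  proof -
    let ?M = "cantor_measure \<kappa>"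
    obtain P Q where PQ: "p = (P, Q)" by (cases p)
    obtain A where A: "P = null_equiv \<kappa> `` {A}" "A \<in> sets ?M" "A \<notin> null_sets ?M"
      using Field_r p PQ by (blast elim: random_condition_cases)
    obtain B where B: "Q = null_equiv \<kappa> `` {B}" "B \<in> sets ?M" "B \<notin> null_sets ?M"
      using Field_r p PQ by (blast elim: random_condition_cases)
    have pos: "measure ?M S > 0 \<longleftrightarrow> S \<notin> null_sets ?M" if "S \<in> sets ?M" for S
      using that by (simp add: null_sets_def cantor.emeasure_eq_measure zero_less_measure_iff)
    obtain u v where u: "u \<in> Field (cohen_forcing \<kappa>)" and v: "dom v = dom u" "xor_map u v \<in> D"
      and Au: "measure ?M (A \<inter> basic_open \<kappa> u) > 0" and Bv: "measure ?M (B \<inter> basic_open \<kappa> v) > 0"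
      using sum_meets_dense[OF A(2) _ B(2) _ D] pos A B by blast
    have v': "v \<in> Field (cohen_forcing \<kappa>)" using u v by (simp add: Field_cohen_forcing)
    have sets: "A \<inter> basic_open \<kappa> u \<in> sets ?M" "B \<inter> basic_open \<kappa> v \<in> sets ?M"
      using A B basic_open_measurable[OF u] basic_open_measurable[OF v'] by auto
    let ?t = "(null_equiv \<kappa> `` {A \<inter> basic_open \<kappa> u}, null_equiv \<kappa> `` {B \<inter> basic_open \<kappa> v})"
    have nonnull: "A \<inter> basic_open \<kappa> u \<notin> null_sets ?M" "B \<inter> basic_open \<kappa> v \<notin> null_sets ?M"
      using Au Bv pos sets by auto
    have empty: "S \<inter> X - S = {}" "S \<inter> X - X = {}" for S X :: "('k \<times> nat \<Rightarrow> bool) set"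
      by blast+
    have diff: "S \<inter> X - S \<in> null_sets ?M" "S \<inter> X - X \<in> null_sets ?M" for S X
      unfolding empty by (rule null_sets.empty_sets)+
    have "?t \<in> sum_conditions \<kappa> (xor_map u v)"
      by (rule sum_conditionsI)
        (use sets nonnull u v v' diff in \<open>simp_all add: extends_in_random_class_iff\<close>)
    moreover have "(?t, p) \<in> ?r"
      using A B sets nonnull diff by (simp add: PQ product_forcing_def random_forcing_class_iff)
    ultimately show ?thesis using v by blast
  qed
qed

end
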